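(* Let $\mathcal{G}=(\mathcal{V},\mathcal{E})$ be a finite connected undirected graph with positive edge weights $c(\{u,v\})>0$, let $s\neq t$ be two distinguished nodes, and let $\mathbf{L}$, $\mathbf{D}$, the expansion parameter $\phi$, and the two finite generalized eigenvalues $\lambda_1\le\lambda_2$ of the pencil $(\mathbf{L},\mathbf{D})$ be as defined in the context, so that $\lambda_2$ is the nonzero finite generalized eigenvalue of $\mathbf{L}\mathbf{x}=\lambda\mathbf{D}\mathbf{x}$. Then $$\frac{\phi^2}{2}\;\le\;\lambda_2\;\le\;2\phi .$$
   Context: Let $n=|\mathcal{V}|$. $\mathbf{L}$ is the $n\times n$ weighted graph Laplacian of $\mathcal{G}$, i.e. $\mathbf{x}^{\mathrm T}\mathbf{L}\mathbf{x}=\sum_{\{u,v\}\in\mathcal{E}}c(\{u,v\})(\mathbf{x}_u-\mathbf{x}_v)^2$. Let $C=2\sum_{\{u,v\}\in\mathcal{E}}c(\{u,v\})$ (twice the total edge weight). Define the node weight function $\mathbf{d}:\mathcal{V}\to\mathbb{R}$ by $\mathbf{d}(u)=C$ if $u=s$ or $u=t$, and $\mathbf{d}(u)=0$ otherwise. Let $\mathbf{D}=\mathrm{diag}(\mathbf{d})$, an $n\times n$ diagonal matrix of rank 2. For $\mathcal{S}\subset\mathcal{V}$ with complement $\bar{\mathcal{S}}$, let $\mathrm{vol}(\mathcal{S})=\sum_{u\in\mathcal{S}}\mathbf{d}(u)$ and $\mathrm{cut}(\mathcal{S},\bar{\mathcal{S}})=\sum_{\{u,v\}\in\mathcal{E},\,u\in\mathcal{S},\,v\in\bar{\mathcal{S}}}c(\{u,v\})$.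 For $\mathcal{S}$ nonempty and proper, let $\phi(\mathcal{S})=\dfrac{\mathrm{cut}(\mathcal{S},\bar{\mathcal{S}})}{\min\{\mathrm{vol}(\mathcal{S}),\mathrm{vol}(\bar{\mathcal{S}})\}}$, with value $+\infty$ when the denominator is $0$; thus $\phi(\mathcal{S})<\infty$ exactly when $\mathcal{S}$ separates $s$ from $t$. The expansion parameter is $\phi=\min_{\mathcal{S}}\phi(\mathcal{S})$ over nonempty proper subsets $\mathcal{S}\subset\mathcal{V}$ (so $\phi$ is the minimum $s$-$t$ cut value divided by $C$). A real number $\lambda$ is a finite generalized eigenvalue of the pencil $(\mathbf{L},\mathbf{D})$ if there is a vector $\mathbf{x}$ with $\mathbf{L}\mathbf{x}=\lambda\mathbf{D}\mathbf{x}$ and $\mathbf{D}\mathbf{x}\neq 0$. The pencil $(\mathbf{L},\mathbf{D})$ has exactly two finite generalized eigenvalues, denoted $\lambda_1\le\lambda_2$. *)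

theory Defs
  imports "HOL-Analysis.Analysis"
begin

text \<open>
  A weighted graph is given by its vertex type \<open>'v\<close> (of class \<open>finite\<close>, the vertex set being
  \<open>UNIV\<close>), a set \<open>E\<close> of two-element vertex sets, and a weight function \<open>c\<close> on such sets of
  which only the values on \<open>E\<close> matter.
\<close>

definition connected_graph :: "'v set set \<Rightarrow> bool" where
  "connected_graph E \<longleftrightarrow> (\<forall>u v. (u, v) \<in> {(a, b). {a, b} \<in> E}\<^sup>*)"

definition laplacian :: "'v::finite set set \<Rightarrow> ('v set \<Rightarrow> real) \<Rightarrow> real ^ 'v ^ 'v" where
  "laplacian E c = (\<chi> u v. if u = v then (\<Sum>e | e \<in> E \<and> u \<in> e. c e)
                           else if {u, v} \<in> E then - c {u, v} else 0)"

definition total_weight :: "'v set set \<Rightarrow> ('v set \<Rightarrow> real) \<Rightarrow> real" where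
  "total_weight E c = 2 * (\<Sum>e\<in>E. c e)"

definition node_weight :: "'v set set \<Rightarrow> ('v set \<Rightarrow> real) \<Rightarrow> 'v \<Rightarrow> 'v \<Rightarrow> 'v \<Rightarrow> real" where
  "node_weight E c s t u = (if u = s \<or> u = t then total_weight E c else 0)"

definition diag_mat :: "('v \<Rightarrow> real) \<Rightarrow> real ^ 'v ^ 'v::finite" where
  "diag_mat d = (\<chi> u v. if u = v then d u else 0)"

definition vol :: "('v \<Rightarrow> real) \<Rightarrow> 'v set \<Rightarrow> real" where
  "vol d S = (\<Sum>u\<in>S. d u)"

definition cut_weight :: "'v set set \<Rightarrow> ('v set \<Rightarrow> real) \<Rightarrow> 'v set \<Rightarrow> 'v set \<Rightarrow> real" where
  "cut_weight E c S T = (\<Sum>e | e \<in> E \<and> (\<exists>u v. e = {u, v} \<and> u \<in> S \<and> v \<in> T). c e)"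

definition set_expansion ::
    "'v set set \<Rightarrow> ('v set \<Rightarrow> real) \<Rightarrow> ('v \<Rightarrow> real) \<Rightarrow> 'v set \<Rightarrow> ereal" where
  "set_expansion E c d S =
     (if min (vol d S) (vol d (- S)) = 0 then \<infinity>
      else ereal (cut_weight E c S (- S) / min (vol d S) (vol d (- S))))"

definition expansion ::
    "'v::finite set set \<Rightarrow> ('v set \<Rightarrow> real) \<Rightarrow> ('v \<Rightarrow> real) \<Rightarrow> ereal" where
  "expansion E c d = Min {set_expansion E c d S | S. S \<noteq> {} \<and> S \<noteq> UNIV}"

definition finite_gen_eigenvalues :: "real ^ 'v ^ 'v \<Rightarrow> real ^ 'v ^ 'v \<Rightarrow> real set" where
  "finite_gen_eigenvalues A B =
     {\<mu>. \<exists>x. A *v x = \<mu> *\<^sub>R (B *v x) \<and> B *v x \<noteq> 0}"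

text \<open>
  The next two facts characterise \<open>laplacian\<close>: it is the symmetric matrix whose quadratic form
  is the sum over the edges \<open>{u, v}\<close> of \<open>c {u, v} * (x $ u - x $ v)\<^sup>2\<close>.
\<close>

lemma transpose_laplacian: "transpose (laplacian E c) = laplacian E c"
  by (simp add: laplacian_def transpose_def vec_eq_iff insert_commute)

lemma laplacian_quadratic_form:
  fixes E :: "'v::finite set set"
  assumes E: "\<And>e. e \<in> E \<Longrightarrow> card e = 2"
    and q: "\<And>u v. {u, v} \<in> E \<Longrightarrow> q {u, v} = (x $ u - x $ v)\<^sup>2"
  shows "x \<bullet> (laplacian E c *v x) = (\<Sum>e\<in>E. c e * q e)"
proof -
  define M where "M e u v = (if u = v then of_bool (u \<in> e) else - of_bool (e = {u, v}) :: real)"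
    for e and u v :: 'v
  have L: "laplacian E c $ u $ v = (\<Sum>e\<in>E. c e * M e u v)" for u v
  proof (cases "u = v")
    case True
    have "(\<Sum>e\<in>E. c e * M e u v) = (\<Sum>e\<in>E. if u \<in> e then c e else 0)"
      using True by (intro sum.cong) (auto simp: M_def)
    also have "\<dots> = (\<Sum>e\<in>E \<inter> {e. u \<in> e}. c e)"
      by (simp add: sum.inter_restrict)
    finally show ?thesis using True by (simp add: laplacian_def Int_def)
  next
    case False
    have "(\<Sum>e\<in>E. c e * M e u v) = (\<Sum>e\<in>E. if e = {u, v} then - c {u, v} else 0)"
      using False by (intro sum.cong) (auto simp: M_def)
    also have "\<dots> = (if {u, v} \<in> E then - c {u, v} else 0)" by simp
    finally show ?thesis using False by (simp add: laplacian_def)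
  qed
  have "x \<bullet> (laplacian E c *v x)
      = (\<Sum>u\<in>UNIV. \<Sum>v\<in>UNIV. \<Sum>e\<in>E. c e * (M e u v * x $ u * x $ v))"
    by (simp add: inner_vec_def matrix_vector_mult_def L sum_distrib_left sum_distrib_right
        mult_ac)
  also have "\<dots> = (\<Sum>e\<in>E. c e * (\<Sum>u\<in>UNIV. \<Sum>v\<in>UNIV. M e u v * x $ u * x $ v))"
    unfolding sum_distrib_left
    by (subst sum.swap[of _ E]) (intro sum.cong refl sum.swap)
  also have "\<dots> = (\<Sum>e\<in>E. c e * q e)"
  proof (rule sum.cong[OF refl])
    fix e assume "e \<in> E"
    then obtain a b where e: "e = {a, b}" "a \<noteq> b" using E card_2_iff by metis
    have M: "M e u v = (of_bool (u = a) - of_bool (u = b)) * (of_bool (v = a) - of_bool (v = b))"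
      for u v using e by (auto simp: M_def doubleton_eq_iff)
    have delta: "(\<Sum>u\<in>UNIV. of_bool (u = w) * x $ u) = x $ w" for w
    proof -
      have "(\<Sum>u\<in>UNIV. of_bool (u = w) * x $ u) = (\<Sum>u\<in>UNIV. if u = w then x $ u else 0)"
        by (rule sum.cong) auto
      also have "\<dots> = x $ w" by simp
      finally show ?thesis .
    qed
    have D: "(\<Sum>u\<in>UNIV. (of_bool (u = a) - of_bool (u = b)) * x $ u) = x $ a - x $ b"
      by (simp only: left_diff_distrib sum_subtractf delta)
    have "(\<Sum>u\<in>UNIV. \<Sum>v\<in>UNIV. M e u v * x $ u * x $ v)
        = (\<Sum>u\<in>UNIV. (of_bool (u = a) - of_bool (u = b)) * x $ u)
        * (\<Sum>v\<in>UNIV. (of_bool (v = a) - of_bool (v = b)) * x $ v)"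
      unfolding sum_product M by (simp add: mult_ac)
    also have "\<dots> = (x $ a - x $ b)\<^sup>2"
      by (simp add: D power2_eq_square)
    finally show "c e * (\<Sum>u\<in>UNIV. \<Sum>v\<in>UNIV. M e u v * x $ u * x $ v) = c e * q e"
      using q \<open>e \<in> E\<close> e by simp
  qed
  finally show ?thesis .
qed

end

theory Submission imports Defs begin

text \<open>
  Summing the entries of \<open>L x = \<lambda> D x\<close> shows that a nonzero eigenvalue forces \<open>x\<^sub>t = - x\<^sub>s\<close>;
  after scaling, \<open>x\<close> is the electrical potential with boundary values \<open>1\<close> at \<open>s\<close> and \<open>- 1\<close> at
  \<open>t\<close>, whose energy is \<open>2 \<lambda>\<^sub>2 C\<close>. By Dirichlet's principle this energy is at most the energy
  \<open>4 cut(S)\<close> of the \<open>\<plusminus> 1\<close>-valued indicator of any separating set \<open>S\<close>, which is the upper bound.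
  For the lower bound, every level set of \<open>x\<close> between \<open>- 1\<close> and \<open>1\<close> separates \<open>s\<close> from \<open>t\<close>, so
  integrating over the levels bounds the total variation of \<open>x\<close> below by \<open>2 \<phi> C\<close>, and
  Cauchy--Schwarz compares the total variation with the energy. This even gives
  \<open>4 \<phi>\<^sup>2 \<le> \<lambda>\<^sub>2\<close>.
\<close>

subsection \<open>Laplacian of a weighted graph\<close>

text \<open>Edges are unordered sets, so the modulus of the difference along an edge is expressed
  through \<open>Max\<close> and \<open>Min\<close>. These also bound the interval of levels at
  which the edge is cut.\<close>

definition spread :: "('v::finite \<Rightarrow> real) \<Rightarrow> 'v set \<Rightarrow> real" where
  "spread f e = Max (f ` e) - Min (f ` e)"

lemma spread_doubleton: "spread f {u, v} = \<bar>f u - f v\<bar>"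
  by (auto simp: spread_def max_def min_def)

lemma laplacian_energy:
  fixes E :: "'v::finite set set"
  assumes "\<forall>e\<in>E. card e = 2"
  shows "x \<bullet> (laplacian E c *v x) = (\<Sum>e\<in>E. c e * (spread (($) x) e)\<^sup>2)"
  using assms by (intro laplacian_quadratic_form) (auto simp: spread_doubleton)

lemma laplacian_sym:
  fixes x y :: "real ^ 'v::finite"
  shows "x \<bullet> (laplacian E c *v y) = y \<bullet> (laplacian E c *v x)"
  by (metis dot_lmul_matrix inner_commute transpose_laplacian transpose_matrix_vector)

lemma laplacian_psd:
  fixes E :: "'v::finite set set"
  assumes "\<forall>e\<in>E. card e = 2" and "\<forall>e\<in>E. c e > 0"
  shows "0 \<le> x \<bullet> (laplacian E c *v x)"
  by (simp add: laplacian_energy assms less_imp_le sum_nonneg)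

text \<open>Adding the all-ones vector \<open>1\<close> to \<open>x\<close> changes no difference
  along an edge, hence not the energy. Expanding the energy of \<open>x + 1\<close> and using
  symmetry, the cross term \<open>x \<bullet> (L *v 1)\<close> must vanish for every
  \<open>x\<close>.\<close>

lemma laplacian_const:
  fixes E :: "'v::finite set set"
  assumes E: "\<forall>e\<in>E. card e = 2"
  shows "laplacian E c *v 1 = 0"
proof -
  let ?L = "laplacian E c"
  have const: "a \<bullet> (?L *v a) = 0" if "a = 1" for a :: "real ^ 'v"
  proof -
    have "spread (($) a) e = 0" if e: "e \<in> E" for e
    proof -
      obtain u v where "e = {u, v}" using E e card_2_iff by metis
      with \<open>a = 1\<close> show ?thesis by (simp add: spread_doubleton)
    qed
    then show ?thesis using E by (simp add: laplacian_energy)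
  qed
  have "x \<bullet> (?L *v 1) = 0" for x
  proof -
    have "(x + 1) \<bullet> (?L *v (x + 1)) = x \<bullet> (?L *v x)"
    proof -
      have "spread (($) (x + 1)) e = spread (($) x) e" if e: "e \<in> E" for e
      proof -
        obtain u v where "e = {u, v}" using E e card_2_iff by metis
        then show ?thesis by (simp add: spread_doubleton)
      qed
      then show ?thesis using E by (simp add: laplacian_energy)
    qed
    moreover have "(x + 1) \<bullet> (?L *v (x + 1))
        = x \<bullet> (?L *v x) + x \<bullet> (?L *v 1) + 1 \<bullet> (?L *v x) + 1 \<bullet> (?L *v 1)"
      by (simp add: matrix_vector_right_distrib inner_add_left inner_add_right)
    ultimately show ?thesis using laplacian_sym[of x E c 1] const[OF refl] by simp
  qed
  then show ?thesis by (meson inner_eq_zero_iff)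
qed

text \<open>Conservation of current: by symmetry, pairing with \<open>1\<close> moves the Laplacian
  onto a constant vector.\<close>

lemma laplacian_sum_zero:
  fixes E :: "'v::finite set set"
  assumes "\<forall>e\<in>E. card e = 2"
  shows "(\<Sum>u\<in>UNIV. (laplacian E c *v x) $ u) = 0"
proof -
  have "(\<Sum>u\<in>UNIV. (laplacian E c *v x) $ u) = 1 \<bullet> (laplacian E c *v x)"
    by (simp add: inner_vec_def)
  also have "\<dots> = x \<bullet> (laplacian E c *v 1)" by (rule laplacian_sym)
  also have "\<dots> = 0" using assms by (simp add: laplacian_const)
  finally show ?thesis .
qed

text \<open>A vanishing sum of nonnegative terms forces \<open>x\<close> to agree across every edge,
  and connectedness carries this along paths.\<close>

lemma laplacian_energy_zero_imp_const:
  fixes E :: "'v::finite set set"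
  assumes E: "\<forall>e\<in>E. card e = 2" and c: "\<forall>e\<in>E. c e > 0"
    and conn: "connected_graph E"
    and zero: "x \<bullet> (laplacian E c *v x) = 0"
  shows "x $ u = x $ v"
proof -
  have "(\<Sum>e\<in>E. c e * (spread (($) x) e)\<^sup>2) = 0"
    using zero E by (simp add: laplacian_energy)
  then have "\<forall>e\<in>E. c e * (spread (($) x) e)\<^sup>2 = 0"
    by (subst (asm) sum_nonneg_eq_0_iff) (auto simp: c less_imp_le)
  then have edge: "x $ a = x $ b" if "{a, b} \<in> E" for a b
    using that c by (force simp: spread_doubleton)
  have "(u, v) \<in> {(a, b). {a, b} \<in> E}\<^sup>*"
    using conn by (simp add: connected_graph_def)
  then show ?thesis by induction (auto simp: edge)
qed

text \<open>An edge has spread 2 if it is cut and 0 otherwise; the factor 4 is the square of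
  2.\<close>

lemma laplacian_pm_indicator_energy:
  fixes E :: "'v::finite set set"
  assumes E: "\<forall>e\<in>E. card e = 2" and w: "w = (\<chi> u. if u \<in> S then 1 else - 1)"
  shows "w \<bullet> (laplacian E c *v w) = 4 * cut_weight E c S (- S)"
proof -
  let ?P = "\<lambda>e. \<exists>u v. e = {u, v} \<and> u \<in> S \<and> v \<in> - S"
  have "w \<bullet> (laplacian E c *v w) = (\<Sum>e\<in>E. if ?P e then 4 * c e else 0)"
    unfolding laplacian_energy[OF E]
  proof (rule sum.cong[OF refl])
    fix e assume "e \<in> E"
    then obtain u v where "e = {u, v}" using E card_2_iff by metis
    then show "c e * (spread (($) w) e)\<^sup>2 = (if ?P e then 4 * c e else 0)"
      by (auto simp: spread_doubleton w doubleton_eq_iff)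
  qed
  also have "\<dots> = 4 * cut_weight E c S (- S)"
    by (simp add: cut_weight_def sum_distrib_left flip: sum.inter_filter)
  finally show ?thesis .
qed

lemma total_weight_pos:
  fixes E :: "'v::finite set set"
  assumes c: "\<forall>e\<in>E. c e > 0" and conn: "connected_graph E" and "s \<noteq> (t :: 'v)"
  shows "0 < total_weight E c"
proof -
  have "E \<noteq> {}" using conn \<open>s \<noteq> t\<close> by (auto simp: connected_graph_def)
  then show ?thesis by (simp add: total_weight_def c sum_pos)
qed

subsection \<open>Potentials and cuts\<close>

text \<open>A discrete coarea argument. Integrating over the level \<theta>, each edge contributes
  its weight on an interval of length \<open>spread f e\<close>, while at each level between
  \<open>f t\<close> and \<open>f s\<close> the contributing edges form a cut separating
  \<open>s\<close> from \<open>t\<close>.\<close>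

lemma total_variation_ge_cut:
  fixes E :: "'v::finite set set" and f :: "'v \<Rightarrow> real"
  assumes E: "\<forall>e\<in>E. card e = 2"
    and c: "\<forall>e\<in>E. c e > 0"
    and cut: "\<And>S. s \<in> S \<Longrightarrow> t \<notin> S \<Longrightarrow> m \<le> cut_weight E c S (- S)"
    and le: "f t \<le> f s"
  shows "m * (f s - f t) \<le> (\<Sum>e\<in>E. c e * spread f e)"
proof -
  let ?I = "\<lambda>e. {Min (f ` e)..<Max (f ` e)}"
  have minmax: "Min (f ` e) \<le> Max (f ` e)" if e: "e \<in> E" for e
  proof -
    obtain u v where "e = {u, v}" using E e card_2_iff by metis
    then show ?thesis by simp
  qed
  have "has_bochner_integral lborel (\<lambda>\<theta>. m * indicator {f t..<f s} \<theta>) (m * (f s - f t))"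
    using has_bochner_integral_real_indicator[of "{f t..<f s}" lborel] le
    by (intro has_bochner_integral_mult_right) simp
  moreover have "has_bochner_integral lborel (\<lambda>\<theta>. \<Sum>e\<in>E. c e * indicator (?I e) \<theta>)
      (\<Sum>e\<in>E. c e * spread f e)"
  proof (intro has_bochner_integral_sum has_bochner_integral_mult_right)
    fix e assume "e \<in> E"
    then show "has_bochner_integral lborel (indicator (?I e)) (spread f e)"
      using has_bochner_integral_real_indicator[of "?I e" lborel] minmax
      by (simp add: spread_def)
  qed
  moreover have "m * indicator {f t..<f s} \<theta> \<le> (\<Sum>e\<in>E. c e * indicator (?I e) \<theta>)" for \<theta>
  proof (cases "\<theta> \<in> {f t..<f s}")
    case True
    \<comment> \<open>The strict inequality matches the half-open intervals: an edge crosses this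
      set exactly when its minimum is at most \<theta> and its maximum exceeds \<theta>.\<close>
    let ?S = "{u. \<theta> < f u}"
    let ?P = "\<lambda>e. \<exists>u v. e = {u, v} \<and> u \<in> ?S \<and> v \<in> - ?S"
    have "m \<le> cut_weight E c ?S (- ?S)" using True by (intro cut) auto
    also have "\<dots> = (\<Sum>e\<in>E. if ?P e then c e else 0)"
      by (simp add: cut_weight_def flip: sum.inter_filter)
    also have "\<dots> = (\<Sum>e\<in>E. c e * indicator (?I e) \<theta>)"
    proof (rule sum.cong[OF refl])
      fix e assume "e \<in> E"
      then obtain u v where e: "e = {u, v}" using E card_2_iff by metis
      have "?P e \<longleftrightarrow> \<theta> \<in> ?I e"
        unfolding e
        by (simp add: doubleton_eq_iff min_le_iff_disj less_max_iff_disj) (metis leD not_less)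
      then show "(if ?P e then c e else 0) = c e * indicator (?I e) \<theta>" by simp
    qed
    finally show ?thesis using True by simp
  next
    case False
    have "0 \<le> (\<Sum>e\<in>E. c e * indicator (?I e) \<theta>)"
      by (intro sum_nonneg mult_nonneg_nonneg) (auto simp: c less_imp_le)
    then show ?thesis using False by simp
  qed
  ultimately show ?thesis
    unfolding has_bochner_integral_iff by (metis (no_types, lifting) integral_mono)
qed

text \<open>The linear map \<open>M\<close> keeps the values at \<open>s\<close> and
  \<open>t\<close> and applies the Laplacian elsewhere. In finite dimension its injectivity, a
  uniqueness statement, yields solvability of the boundary value problem.\<close>

lemma potential_exists:
  fixes E :: "'v::finite set set"
  assumes E: "\<forall>e\<in>E. card e = 2" and c: "\<forall>e\<in>E. c e > 0"
    and conn: "connected_graph E" and st: "s \<noteq> t"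
  obtains x where "x $ s = 1" "x $ t = - 1"
    "\<And>u. u \<noteq> s \<Longrightarrow> u \<noteq> t \<Longrightarrow> (laplacian E c *v x) $ u = 0"
proof -
  let ?L = "laplacian E c"
  define M where "M x = (\<chi> u. if u = s \<or> u = t then x $ u else (?L *v x) $ u)" for x
  have "linear M"
    by (rule linearI) (auto simp: M_def vec_eq_iff matrix_vector_right_distrib
        matrix_vector_mult_scaleR)
  moreover have "inj M"
  proof (subst linear_injective_0[OF \<open>linear M\<close>], intro allI impI)
    fix x assume "M x = 0"
    then have bd: "x $ s = 0" and M0: "\<And>u. (if u = s \<or> u = t then x $ u else (?L *v x) $ u) = 0"
      by (auto simp: M_def vec_eq_iff split: if_splits)
    \<comment> \<open>At \<open>s\<close> and \<open>t\<close> the first factor vanishes, at all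
      other nodes the second. So a kernel vector has zero energy, is constant, and equals its
      boundary value 0.\<close>
    have "x $ u * (?L *v x) $ u = 0" for u
      using M0[of u] by (auto split: if_splits)
    then have "x \<bullet> (?L *v x) = 0" unfolding inner_vec_def by (intro sum.neutral) simp
    then have "x $ u = 0" for u
      using laplacian_energy_zero_imp_const[OF E c conn, of x u s] bd by simp
    then show "x = 0" by (simp add: vec_eq_iff)
  qed
  ultimately have "surj M" by (rule linear_injective_imp_surjective) simp
  then obtain x where x: "(\<chi> u. if u = s then 1 else if u = t then - 1 else 0) = M x"
    by (metis surjD)
  show thesis
  proof
    show "x $ s = 1" using x by (simp add: M_def vec_eq_iff) metis
    show "x $ t = - 1" using x st by (simp add: M_def vec_eq_iff) metis
    show "(?L *v x) $ u = 0" if "u \<noteq> s" "u \<noteq> t" for u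
      using x that by (simp add: M_def vec_eq_iff) metis
  qed
qed

section \<open>Node weights and the expansion as a minimum cut\<close>

lemma diag_mat_mult: "(diag_mat d *v x) $ u = d u * x $ u"
proof -
  have "(diag_mat d *v x) $ u = (\<Sum>v\<in>UNIV. (if u = v then d u else 0) * x $ v)"
    by (simp add: diag_mat_def matrix_vector_mult_def)
  also have "\<dots> = (\<Sum>v\<in>UNIV. if u = v then d u * x $ v else 0)"
    by (rule sum.cong) auto
  also have "\<dots> = d u * x $ u" by simp
  finally show ?thesis .
qed

lemma vol_node_weight:
  fixes S :: "'v::finite set"
  assumes "s \<noteq> t"
  shows "vol (node_weight E c s t) S
    = total_weight E c * (of_bool (s \<in> S) + of_bool (t \<in> S))"
proof -
  have "vol (node_weight E c s t) S = (\<Sum>u\<in>S. (if u = s then total_weight E c else 0)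
      + (if u = t then total_weight E c else 0))"
    unfolding vol_def using assms by (intro sum.cong) (auto simp: node_weight_def)
  then show ?thesis by (simp add: sum.distrib distrib_left)
qed

lemma cut_weight_Compl: "cut_weight E c (- S) S = cut_weight E c S (- S)"
  unfolding cut_weight_def by (rule sum.cong) (auto simp: insert_commute)

text \<open>The smaller of the two volumes is \<open>total_weight E c\<close> if the set separates
  \<open>s\<close> from \<open>t\<close>, and 0 otherwise. Hence only separating sets compete for
  the minimum, all with the same denominator.\<close>

lemma expansion_node_weight:
  fixes E :: "'v::finite set set"
  assumes C: "0 < total_weight E c" and st: "s \<noteq> t"
  obtains S where "s \<in> S" "t \<notin> S"
    "expansion E c (node_weight E c s t) = ereal (cut_weight E c S (- S) / total_weight E c)"
    "\<And>T. s \<in> T \<Longrightarrow> t \<notin> T \<Longrightarrow> cut_weight E c S (- S) \<le> cut_weight E c T (- T)"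
proof -
  let ?C = "total_weight E c" and ?d = "node_weight E c s t"
  let ?X = "{set_expansion E c ?d S | S. S \<noteq> {} \<and> S \<noteq> UNIV}"
  have fin: "finite ?X" by simp
  have sep: "set_expansion E c ?d T = ereal (cut_weight E c T (- T) / ?C)"
    if "(s \<in> T) \<noteq> (t \<in> T)" for T
    using that C by (auto simp: set_expansion_def vol_node_weight[OF st])
  have nsep: "set_expansion E c ?d T = \<infinity>" if "(s \<in> T) = (t \<in> T)" for T
    using that C by (auto simp: set_expansion_def vol_node_weight[OF st])
  have le: "expansion E c ?d \<le> ereal (cut_weight E c T (- T) / ?C)" if "s \<in> T" "t \<notin> T" for T
  proof -
    have "set_expansion E c ?d T \<in> ?X" using that by blast
    then have "expansion E c ?d \<le> set_expansion E c ?d T"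
      unfolding expansion_def by (rule Min_le[OF fin])
    then show ?thesis using sep that by simp
  qed
  have "{s} \<noteq> UNIV" using st by (metis UNIV_I singletonD)
  then have "?X \<noteq> {}" by blast
  then have "expansion E c ?d \<in> ?X" unfolding expansion_def by (rule Min_in[OF fin])
  then obtain S0 where S0: "expansion E c ?d = set_expansion E c ?d S0" by blast
  \<comment> \<open>The set \<open>{s}\<close> already has a finite expansion, so a minimiser cannot
    have an infinite one.\<close>
  have S0_sep: "(s \<in> S0) \<noteq> (t \<in> S0)"
  proof
    assume "(s \<in> S0) = (t \<in> S0)"
    then show False using le[of "{s}"] st nsep[of S0] S0 by simp
  qed
  \<comment> \<open>Cuts are symmetric under complement, so the minimiser can be taken on the side
    of \<open>s\<close>.\<close>
  define S where "S = (if s \<in> S0 then S0 else - S0)"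
  have S: "s \<in> S" "t \<notin> S" "cut_weight E c S (- S) = cut_weight E c S0 (- S0)"
    using S0_sep cut_weight_Compl[of E c S0] by (auto simp: S_def)
  show thesis
  proof
    show "s \<in> S" "t \<notin> S" by fact+
    show eq: "expansion E c ?d = ereal (cut_weight E c S (- S) / ?C)"
      using S(3) S0 sep[OF S0_sep] by simp
    show "cut_weight E c S (- S) \<le> cut_weight E c T (- T)" if "s \<in> T" "t \<notin> T" for T
      using le[OF that] C unfolding eq by (simp add: divide_le_cancel)
  qed
qed

section \<open>The spectrum of the pencil and the two bounds\<close>

theorem theorem2p7:
  fixes E :: "'v::finite set set" and c :: "'v set \<Rightarrow> real" and s t :: 'v
    and L D :: "real ^ 'v ^ 'v" and \<phi> :: ereal
  assumes edges: "\<And>e. e \<in> E \<Longrightarrow> card e = 2"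
    and weights: "\<And>e. e \<in> E \<Longrightarrow> c e > 0"
    and conn: "connected_graph E"
    and st: "s \<noteq> t"
    and L: "L = laplacian E c"
    and D: "D = diag_mat (node_weight E c s t)"
    and phi: "\<phi> = expansion E c (node_weight E c s t)"
  shows "\<exists>\<mu>\<^sub>1 \<mu>\<^sub>2. finite_gen_eigenvalues L D = {\<mu>\<^sub>1, \<mu>\<^sub>2} \<and> \<mu>\<^sub>1 = 0 \<and> \<mu>\<^sub>1 < \<mu>\<^sub>2 \<and>
           \<phi>\<^sup>2 / 2 \<le> ereal \<mu>\<^sub>2 \<and> ereal \<mu>\<^sub>2 \<le> 2 * \<phi>"
proof -
  have card2: "\<forall>e\<in>E. card e = 2" and c_pos: "\<forall>e\<in>E. c e > 0"
    using edges weights by blast+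
  define C where "C = total_weight E c"
  have C: "0 < C" unfolding C_def by (rule total_weight_pos[OF c_pos conn st])
  have D_nth: "(D *v y) $ u = (if u = s \<or> u = t then C * y $ u else 0)" for y u
    by (simp add: D diag_mat_mult node_weight_def C_def)
  have sum_st: "(\<Sum>u\<in>UNIV. if u = s \<or> u = t then g u else 0) = g s + g t" for g :: "'v \<Rightarrow> real"
  proof -
    have "(\<Sum>u\<in>UNIV. if u = s \<or> u = t then g u else 0) = (\<Sum>u\<in>{s, t}. g u)"
      by (rule sum.mono_neutral_cong_right) auto
    then show ?thesis using st by simp
  qed
  have inner_D: "y \<bullet> (D *v z) = C * (y $ s * z $ s + y $ t * z $ t)" for y z
  proof -
    have "y \<bullet> (D *v z) = (\<Sum>u\<in>UNIV. if u = s \<or> u = t then y $ u * (C * z $ u) else 0)"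
      unfolding inner_vec_def by (intro sum.cong) (auto simp: D_nth)
    then show ?thesis unfolding sum_st by (simp add: algebra_simps)
  qed
  have L1: "L *v 1 = 0" using L laplacian_const[OF card2] by simp
  have L_sym: "y \<bullet> (L *v z) = z \<bullet> (L *v y)" for y z
    unfolding L by (rule laplacian_sym)
  obtain x where xs: "x $ s = 1" and xt: "x $ t = - 1"
    and harm: "\<And>u. u \<noteq> s \<Longrightarrow> u \<noteq> t \<Longrightarrow> (L *v x) $ u = 0"
    using potential_exists[OF card2 c_pos conn st] unfolding L by metis
  \<comment> \<open>Forced by the \<open>s\<close>-coordinate of the eigenvalue equation, since
    \<open>x $ s = 1\<close>. The \<open>t\<close>-coordinate then follows because the entries of
    \<open>L *v x\<close> sum to zero and vanish off \<open>s\<close> and \<open>t\<close>.\<close>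
  define \<mu> where "\<mu> = (L *v x) $ s / C"
  have "(\<Sum>u\<in>UNIV. if u = s \<or> u = t then (L *v x) $ u else 0) = (\<Sum>u\<in>UNIV. (L *v x) $ u)"
    by (intro sum.cong) (auto simp: harm)
  then have "(L *v x) $ s + (L *v x) $ t = 0"
    unfolding sum_st using laplacian_sum_zero[OF card2] L by simp
  then have eig: "L *v x = \<mu> *\<^sub>R (D *v x)"
    using C xs xt harm by (auto simp: vec_eq_iff D_nth \<mu>_def)
  have xLw: "w \<bullet> (L *v x) = \<mu> * (C * (w $ s - w $ t))" for w
    by (simp add: eig inner_D xs xt)
  have energy: "x \<bullet> (L *v x) = 2 * \<mu> * C" by (simp add: xLw xs xt)
  have "x \<bullet> (L *v x) \<noteq> 0"
    using laplacian_energy_zero_imp_const[OF card2 c_pos conn, of x s t] xs xt L by auto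
  moreover have psd: "0 \<le> y \<bullet> (L *v y)" for y
    unfolding L by (rule laplacian_psd[OF card2 c_pos])
  ultimately have "0 < 2 * \<mu> * C" using energy psd[of x] by linarith
  then have pos: "0 < \<mu>" using C by (simp add: zero_less_mult_iff)
  have eigs: "finite_gen_eigenvalues L D = {0, \<mu>}"
  proof (intro equalityI subsetI)
    fix \<nu> assume "\<nu> \<in> finite_gen_eigenvalues L D"
    then obtain y where y: "L *v y = \<nu> *\<^sub>R (D *v y)" "D *v y \<noteq> 0"
      by (auto simp: finite_gen_eigenvalues_def)
    \<comment> \<open>The same pairing applied to the right-hand side of the eigenvalue equation
      gives \<nu> times \<open>C * (y $ s + y $ t)\<close>.\<close>
    have "1 \<bullet> (L *v y) = 0" using L_sym[of 1 y] L1 by simp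
    then have yst: "\<nu> = 0 \<or> y $ t = - y $ s" using C by (auto simp: y inner_D)
    show "\<nu> \<in> {0, \<mu>}"
    proof (cases "\<nu> = 0")
      case False
      then have t: "y $ t = - y $ s" using yst by simp
      have "y $ s \<noteq> 0"
      proof
        assume "y $ s = 0"
        then have "D *v y = 0" using t by (auto simp: vec_eq_iff D_nth)
        with y show False by simp
      qed
      \<comment> \<open>The two sides evaluate to \<open>2 * C * y $ s\<close> times \<nu> and times
        \<mu>, so the eigenvalues agree.\<close>
      moreover have "x \<bullet> (L *v y) = y \<bullet> (L *v x)" by (rule L_sym)
      ultimately show ?thesis using C by (simp add: y(1) eig inner_D xs xt t)
    qed simp
  next
    fix \<nu> assume "\<nu> \<in> {0, \<mu>}"
    moreover have "D *v 1 \<noteq> 0" using D_nth[of 1 s] C by force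
    moreover have "D *v x \<noteq> 0" using D_nth[of x s] C xs by force
    ultimately show "\<nu> \<in> finite_gen_eigenvalues L D"
      unfolding finite_gen_eigenvalues_def using eig L1 by auto
  qed
  obtain S where S: "s \<in> S" "t \<notin> S" and phi_S: "\<phi> = ereal (cut_weight E c S (- S) / C)"
    and min_S: "\<And>T. s \<in> T \<Longrightarrow> t \<notin> T \<Longrightarrow> cut_weight E c S (- S) \<le> cut_weight E c T (- T)"
    using expansion_node_weight[OF C[unfolded C_def] st] unfolding phi C_def by metis
  define m where "m = cut_weight E c S (- S)"
  have m: "0 \<le> m" unfolding m_def cut_weight_def
    by (rule sum_nonneg) (simp add: weights less_imp_le)
  have upper: "\<mu> \<le> 2 * (m / C)"
  proof -
    define w :: "real ^ 'v" where "w = (\<chi> u. if u \<in> S then 1 else - 1)"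
    \<comment> \<open>Dirichlet's principle: \<open>w\<close> and \<open>x\<close> agree at
      \<open>s\<close> and \<open>t\<close>, so the cross term \<open>w \<bullet> (L *v x)\<close>
      equals the energy of \<open>x\<close>. That energy is therefore at most the energy
      \<open>4 * m\<close> of \<open>w\<close>.\<close>
    have "0 \<le> (w - x) \<bullet> (L *v (w - x))" by (rule psd)
    also have "\<dots> = w \<bullet> (L *v w) - 2 * (w \<bullet> (L *v x)) + x \<bullet> (L *v x)"
      using L_sym[of x w] by (simp add: matrix_vector_mult_diff_distrib inner_diff_left inner_diff_right)
    also have "w \<bullet> (L *v w) = 4 * m"
      unfolding L m_def by (rule laplacian_pm_indicator_energy[OF card2 w_def])
    also have "w \<bullet> (L *v x) = 2 * \<mu> * C" using S by (simp add: xLw w_def)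
    also note energy
    finally show ?thesis using C by (simp add: field_simps)
  qed
  have lower: "4 * (m / C)\<^sup>2 \<le> \<mu>"
  proof -
    let ?f = "spread (($) x)"
    \<comment> \<open>The factor 2 is the potential difference between \<open>s\<close> and
      \<open>t\<close>.\<close>
    have "2 * m \<le> (\<Sum>e\<in>E. c e * ?f e)"
      using total_variation_ge_cut[OF card2 c_pos, where f = "($) x" and s = s and t = t and m = m]
        min_S xs xt by (simp add: m_def)
    then have "(2 * m)\<^sup>2 \<le> (\<Sum>e\<in>E. c e * ?f e)\<^sup>2" using m by (intro power_mono) auto
    \<comment> \<open>Splitting the weight evenly makes one Cauchy-Schwarz factor the total edge
      weight \<open>C / 2\<close> and the other the energy.\<close>
    also have "\<dots> = (\<Sum>e\<in>E. sqrt (c e) * (sqrt (c e) * ?f e))\<^sup>2"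
      by (intro arg_cong[where f = "\<lambda>a. a\<^sup>2"] sum.cong)
        (auto simp: weights less_imp_le simp flip: mult.assoc)
    also have "\<dots> \<le> (\<Sum>e\<in>E. (sqrt (c e))\<^sup>2) * (\<Sum>e\<in>E. (sqrt (c e) * ?f e)\<^sup>2)"
      by (rule Cauchy_Schwarz_ineq_sum)
    also have "\<dots> = (\<Sum>e\<in>E. c e) * (\<Sum>e\<in>E. c e * (?f e)\<^sup>2)"
      by (simp add: weights less_imp_le power_mult_distrib)
    also have "\<dots> = C / 2 * (2 * \<mu> * C)"
      unfolding energy[symmetric] L laplacian_energy[OF card2] by (simp add: C_def total_weight_def)
    finally show ?thesis using C by (simp add: field_simps power2_eq_square)
  qed
  have "(m / C)\<^sup>2 / 2 \<le> \<mu>" using lower zero_le_power2[of "m / C"] by linarith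
  then have "\<phi>\<^sup>2 / 2 \<le> ereal \<mu>" by (simp add: phi_S m_def)
  moreover have "ereal \<mu> \<le> 2 * \<phi>" using upper by (simp add: phi_S m_def)
  ultimately show ?thesis using eigs pos by blast
qed

end
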